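(* Let $\Gamma$ be a closed subgroup of $\mathrm{E}(d)$ that contains $\mathbb{R}^d$ (the translations), endowed with the metric $\rho_\Gamma$, and let $\Pi$ be a glueable abstract pattern space over $(\mathbb{R}^d,\Gamma)$. Let $\mathcal{P}\in\Pi$, let $D$ be a Delone set in $\mathbb{R}^d$ and $R_0>0$, and assume that $(D,R_0)$ decomposes $\mathcal{P}$. Let $(\mathcal{P}_{\lambda})_{\lambda\in\Lambda}$ be a tuple of components for $\mathcal{P}$ with respect to $(D,R_0)$ and $(P_{\lambda})_{\lambda\in\Lambda}$ the plan for $\mathcal{P}$ with respect to $(D,R_0,(\mathcal{P}_{\lambda}))$. Regard $(P_{\lambda})_{\lambda}$ as an abstract pattern of $\prod_{\lambda\in\Lambda}2^{\Gamma}$, which is an abstract pattern space over $(\Gamma,\Gamma)$. Then $\mathcal{P}$ and $(P_{\lambda})_{\lambda}$ are mutually locally derivable.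
   Context: Conventions: $\mathbb{R}^d$ carries the Euclidean metric $\rho$; $B(x,r)$ is the closed ball in the relevant metric space; $\mathrm{E}(d)\cong\mathbb{R}^d\rtimes\mathrm{O}(d)$ is the isometry group, elements written $(a,A)$; $\rho_\Gamma$ is the restriction to $\Gamma$ of $\rho_{\mathrm{E}(d)}((a,A),(b,B))=\rho(a,b)+\|A-B\|$ (operator norm), a left-invariant metric; $\Gamma_x$ is the isotropy group of $x$; for a group $H$ acting, $\operatorname{Sym}_H\mathcal{Q}=\{\gamma\in H\mid\gamma\mathcal{Q}=\mathcal{Q}\}$. $\mathrm{Cl}(X)$ is the set of closed subsets. Abstract pattern space over $(X,\Gamma)$ ($\Gamma$ acting on $X$ by homeomorphisms): a non-empty set $\Pi$ with a map $\Pi\times\mathrm{Cl}(X)\to\Pi$, $(\mathcal{P},C)\mapsto\mathcal{P}\wedge C$ and an action of $\Gamma$ on $\Pi$ such that (1) $(\mathcal{P}\wedge C_1)\wedge C_2=\mathcal{P}\wedge(C_1\cap C_2)$; (2) for each $\mathcal{P}$ there is a (unique) closed set $\operatorname{supp}\mathcal{P}$ with $\mathcal{P}\wedge C=\mathcal{P}\iff C\supset\operatorname{supp}\mathcal{P}$ for all closed $C$; (3) $(\gamma\mathcal{P})\wedge(\gamma C)=\gamma(\mathcal{P}\wedge C)$. Glueing: $\mathcal{P}\geqq\mathcal{Q}$ means $\mathcal{P}\wedge\operatorname{supp}\mathcal{Q}=\mathcal{Q}$ (a partial order); $\bigvee\Xi$ is the supremum. $\Xi\wedge C=\{\mathcal{P}\wedge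 C\mid\mathcal{P}\in\Xi\}$. $\Xi\subset\Pi$ is pairwise compatible if for any $\mathcal{P},\mathcal{Q}\in\Xi$ some $\mathcal{R}\in\Pi$ satisfies $\mathcal{R}\geqq\mathcal{P}$, $\mathcal{R}\geqq\mathcal{Q}$; locally finite if $\Xi\wedge B(x,r)$ is finite for all $x$ and $r>0$. $\Pi$ is glueable if every locally finite, pairwise compatible $\Xi\subset\Pi$ has a supremum and $\bigvee(\Xi\wedge C)=(\bigvee\Xi)\wedge C$ for all closed $C$. Local derivability: for abstract patterns $\mathcal{P}_1,\mathcal{P}_2$ in abstract pattern spaces over $(X,\Gamma)$, $(Y,\Gamma)$ ($\Gamma$ acting by isometries on proper metric spaces), $\mathcal{P}_2$ is locally derivable from $\mathcal{P}_1$ if there are $x_0\in X$, $y_0\in Y$, $R_0\geqq0$ such that for all $\gamma,\eta\in\Gamma$, $R\geqq0$: $(\gamma\mathcal{P}_1)\wedge B(x_0,R+R_0)=(\eta\mathcal{P}_1)\wedge B(x_0,R+R_0)$ implies $(\gamma\mathcal{P}_2)\wedge B(y_0,R)=(\eta\mathcal{P}_2)\wedge B(y_0,R)$. Mutually locally derivable: each is locally derivable from the other. Delone set: $D\subset\mathbb{R}^d$ that is uniformly discrete (for some $r>0$, $\rho(x,y)>r$ for distinct $x,y\in D$) and relatively dense (for some $R>0$, $D$ meets the interior of every $B(x,R)$). Uniformly discrete subsets form an abstract pattern space over $(\mathbb{R}^d,\Gamma)$ with $D\wedge C=D\cap C$, $\gamma D=\{\gamma x\mid x\in D\}$. Decomposition: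 $(D,R)$ decomposes $\mathcal{P}$ if (1) $D$ is locally derivable from $\mathcal{P}$; (2) $\mathcal{P}=\bigvee\{\mathcal{P}\wedge B(x,R)\mid x\in D\}$; (3) $\sup_{x\in D}\operatorname{card}\operatorname{Sym}_{\Gamma_x}(\mathcal{P}\wedge B(x,R))$ is finite. Tuple of components for $\mathcal{P}$ with respect to $(D,R_0)$: a family $(\mathcal{P}_\lambda)_{\lambda\in\Lambda}$ in $\Pi$ such that (1) $\operatorname{supp}\mathcal{P}_\lambda\subset B(0,R_0)$ for each $\lambda$; (2) for each $x\in D$ there are a unique $\lambda_x\in\Lambda$ and a $\gamma\in\Gamma$ such that $\mathcal{P}\wedge B(x,R_0)=\gamma\mathcal{P}_{\lambda_x}$ and $x=\gamma0$. The plan is $(P_\lambda)_{\lambda\in\Lambda}$ with $P_\lambda=\{\gamma\in\Gamma\mid\gamma0\in D\text{ and }\mathcal{P}\wedge B(\gamma0,R_0)=\gamma\mathcal{P}_\lambda\}$. $2^\Gamma$ is the set of subsets of $\Gamma$ with $A\wedge C=A\cap C$ for closed $C\subset\Gamma$ and action by left multiplication; $\prod_\lambda2^\Gamma$ has componentwise cutting-off and action. *)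

theory Defs
  imports "HOL-Analysis.Analysis" "HOL-Algebra.Group_Action" "HOL-Algebra.Order"
begin

record ('g, 'x, 'p) pattern_structure =
  patterns :: "'p set"
  cut :: "'p \<Rightarrow> 'x set \<Rightarrow> 'p"
  act :: "'g \<Rightarrow> 'p \<Rightarrow> 'p"

text \<open>
  \<open>mv\<close> is the action of the group \<open>G\<close> on the space \<open>X\<close>. As \<^locale>\<open>group_action\<close> demands, the maps
  \<open>mv g\<close> and \<open>act S g\<close> are \<open>undefined\<close> outside \<open>topspace X\<close> and \<open>patterns S\<close>.
\<close>

locale abstract_pattern_space =
  space: group_action G "topspace X" mv + pattern: group_action G "patterns S" "act S"
  for G :: "('g, 'm) monoid_scheme" and X :: "'x topology" and mv :: "'g \<Rightarrow> 'x \<Rightarrow> 'x"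
    and S :: "('g, 'x, 'p) pattern_structure" +
  assumes homeomorphic_mv: "g \<in> carrier G \<Longrightarrow> homeomorphic_map X X (mv g)"
    and patterns_nonempty: "patterns S \<noteq> {}"
    and cut_closed: "\<lbrakk>P \<in> patterns S; closedin X C\<rbrakk> \<Longrightarrow> cut S P C \<in> patterns S"
    and cut_cut: "\<lbrakk>P \<in> patterns S; closedin X C1; closedin X C2\<rbrakk>
      \<Longrightarrow> cut S (cut S P C1) C2 = cut S P (C1 \<inter> C2)"
    and support_exists: "P \<in> patterns S
      \<Longrightarrow> \<exists>K. closedin X K \<and> (\<forall>C. closedin X C \<longrightarrow> (cut S P C = P \<longleftrightarrow> K \<subseteq> C))"
    and cut_equivariant: "\<lbrakk>g \<in> carrier G; P \<in> patterns S; closedin X C\<rbrakk>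
      \<Longrightarrow> cut S (act S g P) (mv g ` C) = act S g (cut S P C)"

definition supp :: "'x topology \<Rightarrow> ('g, 'x, 'p) pattern_structure \<Rightarrow> 'p \<Rightarrow> 'x set"
  where "supp X S P =
    (THE K. closedin X K \<and> (\<forall>C. closedin X C \<longrightarrow> (cut S P C = P \<longleftrightarrow> K \<subseteq> C)))"

lemma supp_eqI:
  assumes "closedin X K" "\<And>C. closedin X C \<Longrightarrow> cut S P C = P \<longleftrightarrow> K \<subseteq> C"
  shows "supp X S P = K"
  unfolding supp_def using assms by (intro the_equality) (auto intro!: antisym)

lemma (in abstract_pattern_space)
  assumes "P \<in> patterns S"
  shows closedin_supp: "closedin X (supp X S P)"
    and cut_eq_iff_supp: "closedin X C \<Longrightarrow> cut S P C = P \<longleftrightarrow> supp X S P \<subseteq> C"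
proof -
  obtain K where K: "closedin X K" "\<forall>C. closedin X C \<longrightarrow> (cut S P C = P \<longleftrightarrow> K \<subseteq> C)"
    using support_exists[OF assms] by blast
  then have "supp X S P = K" by (intro supp_eqI) auto
  with K show "closedin X (supp X S P)"
    "closedin X C \<Longrightarrow> cut S P C = P \<longleftrightarrow> supp X S P \<subseteq> C" by auto
qed

definition pattern_order :: "'x topology \<Rightarrow> ('g, 'x, 'p) pattern_structure \<Rightarrow> 'p gorder"
  where "pattern_order X S =
    \<lparr>carrier = patterns S, eq = (=), le = (\<lambda>Q P. cut S P (supp X S Q) = Q)\<rparr>"

definition cut_family :: "('g, 'x, 'p) pattern_structure \<Rightarrow> 'p set \<Rightarrow> 'x set \<Rightarrow> 'p set"
  where "cut_family S \<Xi> C = (\<lambda>P. cut S P C) ` \<Xi>"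

definition pairwise_compatible :: "'x topology \<Rightarrow> ('g, 'x, 'p) pattern_structure \<Rightarrow> 'p set \<Rightarrow> bool"
  where "pairwise_compatible X S \<Xi> \<longleftrightarrow>
    (\<forall>P\<in>\<Xi>. \<forall>Q\<in>\<Xi>. \<exists>R\<in>patterns S. P \<sqsubseteq>\<^bsub>pattern_order X S\<^esub> R \<and> Q \<sqsubseteq>\<^bsub>pattern_order X S\<^esub> R)"

definition locally_finite_patterns :: "'x metric \<Rightarrow> ('g, 'x, 'p) pattern_structure \<Rightarrow> 'p set \<Rightarrow> bool"
  where "locally_finite_patterns m S \<Xi> \<longleftrightarrow>
    (\<forall>x\<in>mspace m. \<forall>r>0. finite (cut_family S \<Xi> (mcball_of m x r)))"

text \<open>
  A supremum of \<open>\<Xi>\<close> is a least upper bound in \<^const>\<open>pattern_order\<close>, which is a partial order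
  (\<open>partial_order_pattern_order\<close> below), so it is unique. The second \<^term>\<open>is_lub\<close> thus says that the
  supremum of the cut family exists and equals the cut supremum.
\<close>

definition glueable :: "'x metric \<Rightarrow> ('g, 'x, 'p) pattern_structure \<Rightarrow> bool"
  where "glueable m S \<longleftrightarrow>
    (\<forall>\<Xi>. \<Xi> \<subseteq> patterns S \<and> locally_finite_patterns m S \<Xi> \<and>
         pairwise_compatible (mtopology_of m) S \<Xi> \<longrightarrow>
       (\<exists>P. is_lub (pattern_order (mtopology_of m) S) P \<Xi> \<and>
         (\<forall>C. closedin (mtopology_of m) C \<longrightarrow>
           is_lub (pattern_order (mtopology_of m) S) (cut S P C) (cut_family S \<Xi> C))))"

lemma (in abstract_pattern_space) partial_order_pattern_order:
  "partial_order (pattern_order X S)"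
proof unfold_locales
  let ?L = "pattern_order X S"
  have self: "cut S P (supp X S P) = P" if "P \<in> patterns S" for P
    using that cut_eq_iff_supp closedin_supp by blast
  have mono: "supp X S Q \<subseteq> supp X S P"
    if "P \<in> patterns S" "Q \<in> patterns S" "cut S P (supp X S Q) = Q" for P Q
  proof -
    have "cut S Q (supp X S P) = cut S (cut S P (supp X S P)) (supp X S Q)"
      using that closedin_supp cut_cut by (metis Int_commute)
    also have "\<dots> = Q" using self that by simp
    finally show ?thesis using that cut_eq_iff_supp closedin_supp by blast
  qed
  show "x \<sqsubseteq>\<^bsub>?L\<^esub> x" if "x \<in> carrier ?L" for x
    using that self by (simp add: pattern_order_def)
  show eq: "x .=\<^bsub>?L\<^esub> y"
    if "x \<sqsubseteq>\<^bsub>?L\<^esub> y" "y \<sqsubseteq>\<^bsub>?L\<^esub> x" "x \<in> carrier ?L" "y \<in> carrier ?L" for x y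
  proof -
    have *: "cut S y (supp X S x) = x" "cut S x (supp X S y) = y" "x \<in> patterns S" "y \<in> patterns S"
      using that by (simp_all add: pattern_order_def)
    then have "supp X S x = supp X S y" using mono by blast
    then have "x = y" using * self by metis
    then show ?thesis by (simp add: pattern_order_def)
  qed
  show "x \<sqsubseteq>\<^bsub>?L\<^esub> z"
    if "x \<sqsubseteq>\<^bsub>?L\<^esub> y" "y \<sqsubseteq>\<^bsub>?L\<^esub> z" "x \<in> carrier ?L" "y \<in> carrier ?L" "z \<in> carrier ?L" for x y z
  proof -
    have *: "cut S y (supp X S x) = x" "cut S z (supp X S y) = y"
      "x \<in> patterns S" "y \<in> patterns S" "z \<in> patterns S"
      using that by (auto simp: pattern_order_def)
    then have "cut S z (supp X S y \<inter> supp X S x) = x"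
      using cut_cut[of z "supp X S y" "supp X S x"] closedin_supp by simp
    moreover have "supp X S y \<inter> supp X S x = supp X S x" using mono[of y x] * by blast
    ultimately show ?thesis by (simp add: pattern_order_def)
  qed
qed (auto simp: pattern_order_def)

text \<open>\<open>locally_derivable G n T Q m S P\<close>: \<open>Q\<close> in \<open>T\<close> is locally derivable from \<open>P\<close> in \<open>S\<close>.\<close>

definition locally_derivable ::
  "('g, 'k) monoid_scheme \<Rightarrow> 'y metric \<Rightarrow> ('g, 'y, 'q) pattern_structure \<Rightarrow> 'q
    \<Rightarrow> 'x metric \<Rightarrow> ('g, 'x, 'p) pattern_structure \<Rightarrow> 'p \<Rightarrow> bool"
  where "locally_derivable G n T Q m S P \<longleftrightarrow>
    (\<exists>x0\<in>mspace m. \<exists>y0\<in>mspace n. \<exists>R0\<ge>0.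
      \<forall>g\<in>carrier G. \<forall>h\<in>carrier G. \<forall>R\<ge>0.
        cut S (act S g P) (mcball_of m x0 (R + R0)) = cut S (act S h P) (mcball_of m x0 (R + R0))
        \<longrightarrow> cut T (act T g Q) (mcball_of n y0 R) = cut T (act T h Q) (mcball_of n y0 R))"

definition mutually_locally_derivable ::
  "('g, 'k) monoid_scheme \<Rightarrow> 'x metric \<Rightarrow> ('g, 'x, 'p) pattern_structure \<Rightarrow> 'p
    \<Rightarrow> 'y metric \<Rightarrow> ('g, 'y, 'q) pattern_structure \<Rightarrow> 'q \<Rightarrow> bool"
  where "mutually_locally_derivable G m S P n T Q \<longleftrightarrow>
    locally_derivable G n T Q m S P \<and> locally_derivable G m S P n T Q"

text \<open>The pair \<open>(a, A)\<close> stands for the isometry \<open>x \<mapsto> a + A x\<close>.\<close>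

type_synonym 'n isom = "(real^'n) \<times> (real^'n^'n)"

definition euclidean_group :: "('n::finite) isom monoid"
  where "euclidean_group =
    \<lparr>carrier = UNIV \<times> {A. orthogonal_matrix A},
     mult = (\<lambda>(a, A) (b, B). (a + A *v b, A ** B)),
     one = (0, mat 1)\<rparr>"

definition isom_apply :: "('n::finite) isom \<Rightarrow> real^'n \<Rightarrow> real^'n"
  where "isom_apply g x = fst g + snd g *v x"

text \<open>
  The matrix part is compared in the operator norm; \<^const>\<open>norm\<close> on matrices would be the
  Frobenius norm.
\<close>

definition rho_E :: "('n::finite) isom \<Rightarrow> 'n isom \<Rightarrow> real"
  where "rho_E g h = dist (fst g) (fst h) + onorm (\<lambda>x. (snd g - snd h) *v x)"

definition isom_metric :: "('n::finite) isom metric"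
  where "isom_metric = metric (carrier euclidean_group, rho_E)"

definition subgroup_monoid :: "('n::finite) isom set \<Rightarrow> 'n isom monoid"
  where "subgroup_monoid \<Gamma> = euclidean_group\<lparr>carrier := \<Gamma>\<rparr>"

definition subgroup_metric :: "('n::finite) isom set \<Rightarrow> 'n isom metric"
  where "subgroup_metric \<Gamma> = submetric isom_metric \<Gamma>"

definition ud_structure :: "(('n::finite) isom, real^'n, (real^'n) set) pattern_structure"
  where "ud_structure =
    \<lparr>patterns = {D. uniform_discrete D},
     cut = (\<inter>),
     act = (\<lambda>g. \<lambda>D\<in>{D. uniform_discrete D}. isom_apply g ` D)\<rparr>"

text \<open>
  \<^const>\<open>uniform_discrete\<close> asks for distances \<open>\<ge> e\<close> between distinct points rather than \<open>> r\<close>; shrinking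
  the constant passes from one to the other.
\<close>

definition delone_set :: "(real^'n) set \<Rightarrow> bool"
  where "delone_set D \<longleftrightarrow>
    uniform_discrete D \<and> (\<exists>R>0. \<forall>x. D \<inter> interior (cball x R) \<noteq> {})"

definition left_mult :: "('g, 'k) monoid_scheme \<Rightarrow> 'g \<Rightarrow> 'g \<Rightarrow> 'g"
  where "left_mult G g = (\<lambda>h\<in>carrier G. g \<otimes>\<^bsub>G\<^esub> h)"

definition power_structure :: "('g, 'k) monoid_scheme \<Rightarrow> ('g, 'g, 'g set) pattern_structure"
  where "power_structure G =
    \<lparr>patterns = Pow (carrier G),
     cut = (\<inter>),
     act = (\<lambda>g. \<lambda>A\<in>Pow (carrier G). g <#\<^bsub>G\<^esub> A)\<rparr>"

definition product_structure ::
  "'l set \<Rightarrow> ('l \<Rightarrow> ('g, 'x, 'p) pattern_structure) \<Rightarrow> ('g, 'x, 'l \<Rightarrow> 'p) pattern_structure"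
  where "product_structure \<Lambda> T =
    \<lparr>patterns = (\<Pi>\<^sub>E l\<in>\<Lambda>. patterns (T l)),
     cut = (\<lambda>F C. \<lambda>l\<in>\<Lambda>. cut (T l) (F l) C),
     act = (\<lambda>g. \<lambda>F\<in>(\<Pi>\<^sub>E l\<in>\<Lambda>. patterns (T l)). \<lambda>l\<in>\<Lambda>. act (T l) g (F l))\<rparr>"

definition symmetries ::
  "'g set \<Rightarrow> ('g, 'x, 'p) pattern_structure \<Rightarrow> 'p \<Rightarrow> 'g set"
  where "symmetries H S Q = {g \<in> H. act S g Q = Q}"

text \<open>The last conjunct bounds the orders of the symmetry groups; infinite ones must be excluded
  separately, as their \<^const>\<open>card\<close> is \<open>0\<close>.\<close>

definition decomposes ::
  "('n::finite) isom set \<Rightarrow> ('n isom, real^'n, 'p) pattern_structure \<Rightarrow> (real^'n) set \<Rightarrow> real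
    \<Rightarrow> 'p \<Rightarrow> bool"
  where "decomposes \<Gamma> S D R P \<longleftrightarrow>
    locally_derivable (subgroup_monoid \<Gamma>) euclidean_metric ud_structure D euclidean_metric S P \<and>
    is_lub (pattern_order euclidean S) P {cut S P (cball x R) |x. x \<in> D} \<and>
    (\<exists>N. \<forall>x\<in>D.
      let Sym = symmetries (stabilizer (subgroup_monoid \<Gamma>) isom_apply x) S (cut S P (cball x R))
      in finite Sym \<and> card Sym \<le> N)"

definition tuple_of_components ::
  "('n::finite) isom set \<Rightarrow> ('n isom, real^'n, 'p) pattern_structure \<Rightarrow> (real^'n) set \<Rightarrow> real
    \<Rightarrow> 'p \<Rightarrow> 'l set \<Rightarrow> ('l \<Rightarrow> 'p) \<Rightarrow> bool"
  where "tuple_of_components \<Gamma> S D R P \<Lambda> comps \<longleftrightarrow>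
    (\<forall>l\<in>\<Lambda>. comps l \<in> patterns S \<and> supp euclidean S (comps l) \<subseteq> cball 0 R) \<and>
    (\<forall>x\<in>D. \<exists>!l. l \<in> \<Lambda> \<and>
      (\<exists>g\<in>\<Gamma>. cut S P (cball x R) = act S g (comps l) \<and> x = isom_apply g 0))"

definition plan ::
  "('n::finite) isom set \<Rightarrow> ('n isom, real^'n, 'p) pattern_structure \<Rightarrow> (real^'n) set \<Rightarrow> real
    \<Rightarrow> 'p \<Rightarrow> 'l set \<Rightarrow> ('l \<Rightarrow> 'p) \<Rightarrow> 'l \<Rightarrow> 'n isom set"
  where "plan \<Gamma> S D R P \<Lambda> comps = (\<lambda>l\<in>\<Lambda>. {g \<in> \<Gamma>. isom_apply g 0 \<in> D \<and>
    cut S P (cball (isom_apply g 0) R) = act S g (comps l)})"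

abbreviation plan_structure ::
  "('n::finite) isom set \<Rightarrow> 'l set \<Rightarrow> ('n isom, 'n isom, 'l \<Rightarrow> 'n isom set) pattern_structure"
  where "plan_structure \<Gamma> \<Lambda> \<equiv>
    product_structure \<Lambda> (\<lambda>l. power_structure (subgroup_monoid \<Gamma>))"

lemma group_actionI:
  assumes "group G"
    and "\<And>g. g \<in> carrier G \<Longrightarrow> f g \<in> extensional E"
    and cl: "\<And>g x. \<lbrakk>g \<in> carrier G; x \<in> E\<rbrakk> \<Longrightarrow> f g x \<in> E"
    and mult: "\<And>g h x. \<lbrakk>g \<in> carrier G; h \<in> carrier G; x \<in> E\<rbrakk> \<Longrightarrow> f (g \<otimes>\<^bsub>G\<^esub> h) x = f g (f h x)"
    and one: "\<And>x. x \<in> E \<Longrightarrow> f \<one>\<^bsub>G\<^esub> x = x"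
  shows "group_action G E f"
proof -
  interpret G: group G by fact
  have bij: "f g \<in> Bij E" if g: "g \<in> carrier G" for g
  proof -
    have "bij_betw (f g) E E"
      by (rule bij_betw_byWitness[where f' = "f (inv\<^bsub>G\<^esub> g)"])
        (use g cl one in \<open>auto simp flip: mult\<close>)
    then show ?thesis using assms(2)[OF g] by (auto simp: Bij_def)
  qed
  have "f (g \<otimes>\<^bsub>G\<^esub> h) = compose E (f g) (f h)" if "g \<in> carrier G" "h \<in> carrier G" for g h
    by (rule extensionalityI[where A = E])
      (use that assms(2)[of "g \<otimes>\<^bsub>G\<^esub> h"] mult in \<open>auto simp: compose_def\<close>)
  then have "f \<in> hom G (BijGroup E)"
    using bij by (auto simp: hom_def BijGroup_def)
  then show ?thesis
    by (simp add: group_action_def group_hom_def group_hom_axioms_def group_BijGroup G.is_group)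
qed

lemma group_euclidean_group: "group (euclidean_group :: ('n::finite) isom monoid)"
proof (rule groupI)
  fix g :: "'n isom" assume "g \<in> carrier euclidean_group"
  then obtain a A where g: "g = (a, A)" "orthogonal_matrix A"
    by (auto simp: euclidean_group_def)
  show "\<exists>h\<in>carrier euclidean_group. h \<otimes>\<^bsub>euclidean_group\<^esub> g = \<one>\<^bsub>euclidean_group\<^esub>"
    by (rule bexI[where x = "(- (transpose A *v a), transpose A)"])
      (use g in \<open>auto simp: euclidean_group_def orthogonal_matrix_def\<close>)
qed (auto simp: euclidean_group_def orthogonal_matrix_mul orthogonal_matrix_id
  matrix_mul_assoc matrix_vector_right_distrib matrix_vector_mul_assoc)

lemma Metric_space_rho_E: "Metric_space (carrier euclidean_group) (rho_E :: ('n::finite) isom \<Rightarrow> _)"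
proof
  have bl: "bounded_linear (\<lambda>x. A *v x)" for A :: "real^'n^'n"
    by (rule matrix_vector_mul_bounded_linear)
  show "0 \<le> rho_E x y" for x y :: "'n isom"
    unfolding rho_E_def by (intro add_nonneg_nonneg onorm_pos_le bl) auto
  show "rho_E x y = rho_E y x" for x y :: "'n isom"
  proof -
    have "(\<lambda>v. (snd y - snd x) *v v) = (\<lambda>v. - ((snd x - snd y) *v v))"
      by (simp add: matrix_vector_mult_diff_rdistrib)
    then show ?thesis
      using onorm_neg[of "\<lambda>v. (snd x - snd y) *v v"] by (simp add: rho_E_def dist_commute)
  qed
  show "rho_E x y = 0 \<longleftrightarrow> x = y" for x y :: "'n isom"
  proof -
    have "rho_E x y = 0 \<longleftrightarrow> dist (fst x) (fst y) = 0 \<and> onorm (\<lambda>v. (snd x - snd y) *v v) = 0"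
      unfolding rho_E_def by (intro add_nonneg_eq_0_iff onorm_pos_le bl) auto
    also have "\<dots> \<longleftrightarrow> fst x = fst y \<and> (\<forall>v. snd x *v v = snd y *v v)"
      using onorm_eq_0[OF bl, of "snd x - snd y"] by (simp add: matrix_vector_mult_diff_rdistrib)
    also have "\<dots> \<longleftrightarrow> x = y"
      by (auto simp: matrix_eq prod_eq_iff)
    finally show ?thesis .
  qed
  show "rho_E x z \<le> rho_E x y + rho_E y z" for x y z :: "'n isom"
  proof -
    have "onorm (\<lambda>v. (snd x - snd z) *v v)
      \<le> onorm (\<lambda>v. (snd x - snd y) *v v) + onorm (\<lambda>v. (snd y - snd z) *v v)"
      using onorm_triangle[OF bl bl, of "snd x - snd y" "snd y - snd z"]
      by (simp add: matrix_vector_mult_diff_rdistrib)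
    then show ?thesis
      unfolding rho_E_def using dist_triangle[of "fst x" "fst z" "fst y"] by linarith
  qed
qed

lemma mspace_isom_metric [simp]: "mspace isom_metric = carrier euclidean_group"
  and mdist_isom_metric [simp]: "mdist isom_metric = rho_E"
  using Metric_space.mspace_metric[OF Metric_space_rho_E]
    Metric_space.mdist_metric[OF Metric_space_rho_E] by (auto simp: isom_metric_def)

lemma isom_apply_mult:
  "isom_apply (g \<otimes>\<^bsub>euclidean_group\<^esub> h) x = isom_apply g (isom_apply h x)"
  by (simp add: isom_apply_def euclidean_group_def case_prod_beta matrix_vector_right_distrib
    matrix_vector_mul_assoc)

lemma isom_apply_one: "isom_apply \<one>\<^bsub>euclidean_group\<^esub> x = x"
  by (simp add: isom_apply_def euclidean_group_def)

lemma norm_snd_isom: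
  assumes "g \<in> carrier euclidean_group"
  shows "norm (snd g *v v) = norm v"
proof -
  have "orthogonal_transformation ((*v) (snd g))"
    using assms by (auto simp: orthogonal_transformation_matrix euclidean_group_def)
  then show ?thesis by (simp add: orthogonal_transformation)
qed

lemma dist_isom_apply:
  assumes "g \<in> carrier euclidean_group"
  shows "dist (isom_apply g x) (isom_apply g y) = dist x y"
  using norm_snd_isom[OF assms, of "x - y"]
  by (simp add: isom_apply_def dist_norm matrix_vector_mult_diff_distrib)

lemma rho_E_left_invariant:
  assumes "g \<in> carrier euclidean_group"
  shows "rho_E (g \<otimes>\<^bsub>euclidean_group\<^esub> h) (g \<otimes>\<^bsub>euclidean_group\<^esub> k) = rho_E h k"
proof -
  have "(snd g ** snd h - snd g ** snd k) *v v = snd g *v ((snd h - snd k) *v v)" for v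
    by (simp add: matrix_vector_mult_diff_rdistrib matrix_vector_mult_diff_distrib
      matrix_vector_mul_assoc)
  then have "onorm (\<lambda>v. (snd g ** snd h - snd g ** snd k) *v v)
    = onorm (\<lambda>v. (snd h - snd k) *v v)"
    by (simp add: onorm_def norm_snd_isom[OF assms])
  moreover have "dist (fst g + snd g *v fst h) (fst g + snd g *v fst k) = dist (fst h) (fst k)"
    using dist_isom_apply[OF assms, of "fst h" "fst k"] by (simp add: isom_apply_def)
  ultimately show ?thesis by (simp add: rho_E_def euclidean_group_def case_prod_beta)
qed

lemma isometry_imp_homeomorphic_map_of:
  assumes "f ` mspace m = mspace m"
    and "\<And>x y. \<lbrakk>x \<in> mspace m; y \<in> mspace m\<rbrakk> \<Longrightarrow> mdist m (f x) (f y) = mdist m x y"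
  shows "homeomorphic_map (mtopology_of m) (mtopology_of m) f"
  unfolding mtopology_of_def using assms
  by (intro Metric_space12.isometry_imp_homeomorphic_map Metric_space12_mspace_mdist) auto

context
  fixes \<Gamma> :: "('n::finite) isom set"
  assumes subgroup: "subgroup \<Gamma> euclidean_group"
begin

lemma group_subgroup_monoid: "group (subgroup_monoid \<Gamma>)"
  unfolding subgroup_monoid_def
  by (rule subgroup.subgroup_is_group[OF subgroup group_euclidean_group])

lemma subgroup_monoid_simps:
  "carrier (subgroup_monoid \<Gamma>) = \<Gamma>"
  "g \<otimes>\<^bsub>subgroup_monoid \<Gamma>\<^esub> h = g \<otimes>\<^bsub>euclidean_group\<^esub> h"
  "\<one>\<^bsub>subgroup_monoid \<Gamma>\<^esub> = \<one>\<^bsub>euclidean_group\<^esub>"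
  by (auto simp: subgroup_monoid_def)

lemma subgroup_carrier: "g \<in> \<Gamma> \<Longrightarrow> g \<in> carrier euclidean_group"
  using subgroup.subset[OF subgroup] by blast

lemma mspace_subgroup_metric: "mspace (subgroup_metric \<Gamma>) = \<Gamma>"
  using subgroup_carrier by (auto simp: subgroup_metric_def)

lemma mdist_subgroup_metric: "mdist (subgroup_metric \<Gamma>) = rho_E"
  by (simp add: subgroup_metric_def)

lemma group_action_isom_apply: "group_action (subgroup_monoid \<Gamma>) UNIV isom_apply"
  by (rule group_actionI)
    (auto simp: group_subgroup_monoid subgroup_monoid_simps isom_apply_mult isom_apply_one)

lemma homeomorphic_map_isom_apply:
  assumes "g \<in> \<Gamma>"
  shows "homeomorphic_map euclidean euclidean (isom_apply g)"
  using isometry_imp_homeomorphic_map_of[of "isom_apply g" euclidean_metric]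
    group_action.surj_prop[OF group_action_isom_apply, of g]
    dist_isom_apply[OF subgroup_carrier[OF assms]] assms
  by (simp add: subgroup_monoid_simps)

lemma group_action_left_mult:
  "group_action (subgroup_monoid \<Gamma>) \<Gamma> (left_mult (subgroup_monoid \<Gamma>))"
proof -
  interpret G: group "subgroup_monoid \<Gamma>" by (rule group_subgroup_monoid)
  have "group_action (subgroup_monoid \<Gamma>) (carrier (subgroup_monoid \<Gamma>)) (left_mult (subgroup_monoid \<Gamma>))"
    by (rule group_actionI) (auto simp: group_subgroup_monoid left_mult_def G.m_assoc)
  then show ?thesis by (simp add: subgroup_monoid_simps)
qed

lemma homeomorphic_map_left_mult:
  assumes "g \<in> \<Gamma>"
  shows "homeomorphic_map (mtopology_of (subgroup_metric \<Gamma>)) (mtopology_of (subgroup_metric \<Gamma>))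
    (left_mult (subgroup_monoid \<Gamma>) g)"
  using group_action.surj_prop[OF group_action_left_mult, of g] assms subgroup_carrier
  by (intro isometry_imp_homeomorphic_map_of)
    (auto simp: mspace_subgroup_metric mdist_subgroup_metric left_mult_def subgroup_monoid_simps
      rho_E_left_invariant)

lemma uniform_discrete_isom_image:
  assumes "g \<in> \<Gamma>" "uniform_discrete D"
  shows "uniform_discrete (isom_apply g ` D)"
  using assms(2) unfolding uniform_discrete_def
  by (auto simp: dist_isom_apply[OF subgroup_carrier[OF assms(1)]])

lemma abstract_pattern_space_ud:
  "abstract_pattern_space (subgroup_monoid \<Gamma>) euclidean isom_apply ud_structure"
proof -
  have act: "group_action (subgroup_monoid \<Gamma>) (patterns ud_structure) (act ud_structure)"
    by (rule group_actionI)
      (auto simp: group_subgroup_monoid ud_structure_def subgroup_monoid_simps image_image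
        isom_apply_mult isom_apply_one uniform_discrete_isom_image)
  have inj: "inj (isom_apply g)" if "g \<in> \<Gamma>" for g
    using group_action.inj_prop[OF group_action_isom_apply, of g] that
    by (simp add: subgroup_monoid_simps)
  have UD_Int: "uniform_discrete (D \<inter> C)" if "uniform_discrete D" for D C :: "(real^'n) set"
    using that by (rule uniform_discrete_subset) auto
  show ?thesis
  proof (intro abstract_pattern_space.intro abstract_pattern_space_axioms.intro)
    show "group_action (subgroup_monoid \<Gamma>) (topspace euclidean) isom_apply"
      using group_action_isom_apply by simp
    show "patterns (ud_structure :: ('n isom, _, _) pattern_structure) \<noteq> {}"
      by (auto simp: ud_structure_def intro: exI[where x = "{}"])
    show "\<exists>K. closedin euclidean K \<and> (\<forall>C. closedin euclidean C \<longrightarrow>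
        (cut (ud_structure :: ('n isom, _, _) pattern_structure) D C = D \<longleftrightarrow> K \<subseteq> C))"
      if "D \<in> patterns (ud_structure :: ('n isom, _, _) pattern_structure)" for D
      using that uniform_discrete_imp_closed[of D]
      by (intro exI[where x = D]) (auto simp: ud_structure_def)
  qed (use act homeomorphic_map_isom_apply inj UD_Int in
      \<open>auto simp: ud_structure_def subgroup_monoid_simps Int_assoc image_Int\<close>)
qed

lemma abstract_pattern_space_power:
  "abstract_pattern_space (subgroup_monoid \<Gamma>) (mtopology_of (subgroup_metric \<Gamma>))
    (left_mult (subgroup_monoid \<Gamma>)) (power_structure (subgroup_monoid \<Gamma>))"
proof -
  let ?G = "subgroup_monoid \<Gamma>" and ?X = "mtopology_of (subgroup_metric \<Gamma>)"
  interpret G: group ?G by (rule group_subgroup_monoid)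
  have top: "topspace ?X = \<Gamma>" by (simp add: mspace_subgroup_metric)
  have carrier: "carrier ?G = \<Gamma>" by (simp add: subgroup_monoid_simps)
  have act: "group_action ?G (patterns (power_structure ?G)) (act (power_structure ?G))"
    by (rule group_actionI)
      (auto simp: group_subgroup_monoid power_structure_def G.lcos_m_assoc G.l_coset_subset_G
        G.lcos_mult_one subset_iff dest: G.l_coset_subset_G[THEN subsetD, rotated])
  have lmult: "left_mult ?G g ` A = g <#\<^bsub>?G\<^esub> A" if "A \<subseteq> \<Gamma>" for g A
    using that by (auto simp: left_mult_def l_coset_def carrier)
  have inj: "inj_on (left_mult ?G g) \<Gamma>" if "g \<in> \<Gamma>" for g
    using group_action.inj_prop[OF group_action_left_mult, of g] that by (simp add: carrier)
  show ?thesis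
  proof (intro abstract_pattern_space.intro abstract_pattern_space_axioms.intro)
    show "group_action ?G (topspace ?X) (left_mult ?G)"
      using group_action_left_mult top by simp
    show "\<exists>K. closedin ?X K \<and> (\<forall>C. closedin ?X C \<longrightarrow>
        (cut (power_structure ?G) A C = A \<longleftrightarrow> K \<subseteq> C))"
      if "A \<in> patterns (power_structure ?G)" for A
    proof -
      have "A \<subseteq> topspace ?X" using that top carrier by (simp add: power_structure_def)
      then have "A \<inter> C = A \<longleftrightarrow> ?X closure_of A \<subseteq> C" if "closedin ?X C" for C
        using closure_of_minimal[of A C ?X] closure_of_subset[of A ?X] that by blast
      then show ?thesis
        by (intro exI[where x = "?X closure_of A"]) (simp add: power_structure_def)
    qed
    show "cut (power_structure ?G) (act (power_structure ?G) g A) (left_mult ?G g ` C)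
        = act (power_structure ?G) g (cut (power_structure ?G) A C)"
      if "g \<in> carrier ?G" "A \<in> patterns (power_structure ?G)" "closedin ?X C" for g A C
    proof -
      have A: "A \<subseteq> \<Gamma>" and C: "C \<subseteq> \<Gamma>" and g: "g \<in> \<Gamma>"
        using that closedin_subset[of ?X C] top carrier by (auto simp: power_structure_def)
      have "(g <#\<^bsub>?G\<^esub> A) \<inter> left_mult ?G g ` C = g <#\<^bsub>?G\<^esub> (A \<inter> C)"
        using inj_on_image_Int[OF inj[OF g] A C] lmult[OF A, of g] lmult[of "A \<inter> C" g] A
        by (simp add: inf.coboundedI1)
      then show ?thesis using A by (auto simp: power_structure_def carrier)
    qed
  qed (use act homeomorphic_map_left_mult carrier in
      \<open>auto simp: power_structure_def Int_assoc\<close>)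
qed

end

lemma abstract_pattern_space_product:
  assumes "\<Lambda> \<noteq> {}" and T: "\<And>l. l \<in> \<Lambda> \<Longrightarrow> abstract_pattern_space G X mv (T l)"
  shows "abstract_pattern_space G X mv (product_structure \<Lambda> T)"
proof -
  let ?S = "product_structure \<Lambda> T"
  obtain l0 where l0: "l0 \<in> \<Lambda>" using assms(1) by blast
  interpret L0: abstract_pattern_space G X mv "T l0" using T[OF l0] .
  note act_T = abstract_pattern_space.axioms(2)[OF T]
  have group: "group G" using L0.space.group_hom by (simp add: group_hom_def)
  have act_cl: "act (T l) g p \<in> patterns (T l)"
    if "l \<in> \<Lambda>" "g \<in> carrier G" "p \<in> patterns (T l)" for l g p
    using group_action.element_image[OF act_T] that by blast
  have act_one: "act (T l) \<one>\<^bsub>G\<^esub> p = p" if "l \<in> \<Lambda>" "p \<in> patterns (T l)" for l p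
    using group_action.id_eq_one[OF act_T[OF that(1)]] that(2) by (metis restrict_apply')
  have act: "group_action G (patterns ?S) (act ?S)"
  proof (rule group_actionI[OF group])
    show "act ?S (g \<otimes>\<^bsub>G\<^esub> h) F = act ?S g (act ?S h F)"
      if "g \<in> carrier G" "h \<in> carrier G" "F \<in> patterns ?S" for g h F
      using that act_cl group_action.composition_rule[OF act_T]
      by (auto simp: product_structure_def PiE_iff intro!: restrict_ext)
    show "act ?S \<one>\<^bsub>G\<^esub> F = F" if "F \<in> patterns ?S" for F
      using that act_one
      by (auto simp: product_structure_def fun_eq_iff PiE_iff extensional_def restrict_def)
  qed (auto simp: product_structure_def act_cl PiE_iff)
  show ?thesis
  proof (intro abstract_pattern_space.intro abstract_pattern_space_axioms.intro)
    show "group_action G (topspace X) mv" by (rule L0.space.group_action_axioms)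
    show "group_action G (patterns ?S) (act ?S)" by (rule act)
    show "homeomorphic_map X X (mv g)" if "g \<in> carrier G" for g
      using that by (rule L0.homeomorphic_mv)
    show "patterns ?S \<noteq> {}"
      using abstract_pattern_space.patterns_nonempty[OF T]
      by (simp add: product_structure_def PiE_eq_empty_iff)
    show "cut ?S F C \<in> patterns ?S" if "F \<in> patterns ?S" "closedin X C" for F C
      using that abstract_pattern_space.cut_closed[OF T]
      by (auto simp: product_structure_def PiE_iff)
    show "cut ?S (cut ?S F C1) C2 = cut ?S F (C1 \<inter> C2)"
      if "F \<in> patterns ?S" "closedin X C1" "closedin X C2" for F C1 C2
      using that abstract_pattern_space.cut_cut[OF T]
      by (auto simp: product_structure_def PiE_iff fun_eq_iff restrict_def)
    show "cut ?S (act ?S g F) (mv g ` C) = act ?S g (cut ?S F C)"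
      if "g \<in> carrier G" "F \<in> patterns ?S" "closedin X C" for g F C
      using that abstract_pattern_space.cut_equivariant[OF T]
        abstract_pattern_space.cut_closed[OF T]
      by (auto simp: product_structure_def PiE_iff intro!: restrict_ext)
    show "\<exists>K. closedin X K \<and> (\<forall>C. closedin X C \<longrightarrow> (cut ?S F C = F \<longleftrightarrow> K \<subseteq> C))"
      if F: "F \<in> patterns ?S" for F
    proof -
      let ?U = "\<Union>l\<in>\<Lambda>. supp X (T l) (F l)"
      have Fl: "F l \<in> patterns (T l)" if "l \<in> \<Lambda>" for l
        using F that by (auto simp: product_structure_def)
      have "cut ?S F C = F \<longleftrightarrow> X closure_of ?U \<subseteq> C" if C: "closedin X C" for C
      proof -
        have "cut ?S F C = F \<longleftrightarrow> (\<forall>l\<in>\<Lambda>. cut (T l) (F l) C = F l)"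
          using F by (auto simp: product_structure_def PiE_iff fun_eq_iff restrict_def extensional_def)
        also have "\<dots> \<longleftrightarrow> ?U \<subseteq> C"
          using abstract_pattern_space.cut_eq_iff_supp[OF T Fl C] by auto
        also have "\<dots> \<longleftrightarrow> X closure_of ?U \<subseteq> C"
        proof
          have "?U \<subseteq> topspace X"
            using abstract_pattern_space.closedin_supp[OF T Fl] closedin_subset by fast
          then show "?U \<subseteq> C" if "X closure_of ?U \<subseteq> C"
            using that closure_of_subset[of ?U X] by blast
        qed (use C closure_of_minimal in blast)
        finally show ?thesis .
      qed
      then show ?thesis by (intro exI[where x = "X closure_of ?U"]) simp
    qed
  qed
qed

text \<open>
  An index set of a tuple of components for a Delone set is automatically non-empty, so the next
  two lemmas cover every plan.
\<close>

lemma abstract_pattern_space_plan_structure: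
  assumes "subgroup \<Gamma> euclidean_group" "\<Lambda> \<noteq> {}"
  shows "abstract_pattern_space (subgroup_monoid \<Gamma>) (mtopology_of (subgroup_metric \<Gamma>))
    (left_mult (subgroup_monoid \<Gamma>)) (plan_structure \<Gamma> \<Lambda>)"
  using assms by (intro abstract_pattern_space_product abstract_pattern_space_power)

lemma plan_in_patterns: "plan \<Gamma> S D R P \<Lambda> comps \<in> patterns (plan_structure \<Gamma> \<Lambda>)"
  by (auto simp: plan_def product_structure_def power_structure_def subgroup_monoid_def)

end

theory Submission
  imports Defs
begin

text \<open>
  Local derivability compares two translates \<open>gP\<close> and \<open>hP\<close> near a base point, so it helps that
  translating commutes with taking the plan: \<open>g\<close> times the plan of \<open>(D, P)\<close> is the plan of
  \<open>(gD, gP)\<close> (\<open>plan_equivariant\<close>). The base points are \<open>0\<close> in the space and \<open>\<one>\<close> in the group. For an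
  isometry \<open>k\<close>, the distance from \<open>\<one>\<close> to \<open>k\<close> and the norm of \<open>k0\<close> differ by at most \<open>2\<close>, because two
  orthogonal matrices differ by at most \<open>2\<close> in the operator norm (\<open>rho_E_one_bounds\<close>). Hence
  balls about \<open>\<one>\<close> and balls about \<open>0\<close> capture the same elements of a plan up to a bounded change
  of radius.

  The pattern determines the plan: whether \<open>k\<close> belongs to the plan of \<open>(gD, gP)\<close> depends on whether
  \<open>k0\<close> is in \<open>gD\<close>, which can be read off from \<open>gP\<close> near \<open>k0\<close> since \<open>D\<close> is locally derivable from \<open>P\<close>,
  and on the part of \<open>gP\<close> in the ball of radius \<open>R0\<close> about \<open>k0\<close>.

  The plan determines the pattern: every \<open>x \<in> gD\<close> is \<open>k0\<close> for some \<open>k\<close> that the plan of \<open>(gD, gP)\<close>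
  contains at some index \<open>l\<close>, and then the part of \<open>gP\<close> in the ball about \<open>x\<close> is \<open>k\<close> times the
  component with index \<open>l\<close>. Now \<open>gP\<close> is the supremum of these parts, and by glueability cutting commutes
  with the supremum, so \<open>gP\<close> cut by \<open>C\<close> is the supremum of the parts cut by \<open>C\<close>. Parts whose balls
  miss \<open>C\<close> become the least pattern and do not affect the supremum, so that only the points of
  \<open>gD\<close> near \<open>C\<close> matter (\<open>cut_eq_of_ball_patches\<close>).
\<close>

section \<open>The glueing order\<close>

context abstract_pattern_space
begin

abbreviation L where "L \<equiv> pattern_order X S"

lemma act_closed: "\<lbrakk>g \<in> carrier G; P \<in> patterns S\<rbrakk> \<Longrightarrow> act S g P \<in> patterns S"
  using pattern.element_image by blast

lemma act_inv_cancel: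
  assumes "g \<in> carrier G" "P \<in> patterns S"
  shows "act S (inv\<^bsub>G\<^esub> g) (act S g P) = P" "act S g (act S (inv\<^bsub>G\<^esub> g) P) = P"
proof -
  interpret group G using space.group_hom by (simp add: group_hom_def)
  show "act S (inv\<^bsub>G\<^esub> g) (act S g P) = P"
    using pattern.orbit_sym_aux[OF assms refl] .
  show "act S g (act S (inv\<^bsub>G\<^esub> g) P) = P"
    using pattern.orbit_sym_aux[of "inv\<^bsub>G\<^esub> g" P, OF _ _ refl] assms by simp
qed

text \<open>
  Support-free form of the order. It makes the action visibly monotone, since equivariance is
  assumed for cuts and not for supports.
\<close>

lemma le_iff_cut:
  assumes P: "P \<in> patterns S" and Q: "Q \<in> patterns S"
  shows "Q \<sqsubseteq>\<^bsub>L\<^esub> P \<longleftrightarrow> (\<exists>C. closedin X C \<and> Q = cut S P C)"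
proof
  assume "Q \<sqsubseteq>\<^bsub>L\<^esub> P"
  then have "Q = cut S P (supp X S Q)" by (simp add: pattern_order_def)
  then show "\<exists>C. closedin X C \<and> Q = cut S P C" using closedin_supp[OF Q] by blast
next
  assume "\<exists>C. closedin X C \<and> Q = cut S P C"
  then obtain C where C: "closedin X C" and QC: "Q = cut S P C" by blast
  have "cut S Q C = Q" using QC cut_cut[OF P C C] by simp
  then have sub: "supp X S Q \<subseteq> C" using cut_eq_iff_supp[OF Q C] by simp
  have "cut S P (supp X S Q) = cut S P (C \<inter> supp X S Q)" using sub by (simp add: Int_absorb1)
  also have "\<dots> = cut S Q (supp X S Q)" using QC cut_cut[OF P C closedin_supp[OF Q]] by simp
  also have "\<dots> = Q" using cut_eq_iff_supp[OF Q closedin_supp[OF Q]] by simp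
  finally show "Q \<sqsubseteq>\<^bsub>L\<^esub> P" by (simp add: pattern_order_def)
qed

lemma act_mono:
  assumes g: "g \<in> carrier G" and P: "P \<in> patterns S" and Q: "Q \<in> patterns S"
    and le: "Q \<sqsubseteq>\<^bsub>L\<^esub> P"
  shows "act S g Q \<sqsubseteq>\<^bsub>L\<^esub> act S g P"
proof -
  obtain C where C: "closedin X C" "Q = cut S P C" using le le_iff_cut[OF P Q] by blast
  have "closedin X (mv g ` C)"
    using homeomorphic_map_closedness[OF homeomorphic_mv[OF g]] C closedin_subset by blast
  then show ?thesis
    using C cut_equivariant[OF g P C(1)] act_closed[OF g] le_iff_cut P Q by metis
qed

lemma act_is_lub:
  assumes g: "g \<in> carrier G" and A: "A \<subseteq> patterns S" and lub: "is_lub L P A"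
  shows "is_lub L (act S g P) (act S g ` A)"
proof -
  interpret group G using space.group_hom by (simp add: group_hom_def)
  have P: "P \<in> patterns S" using lub by (simp add: least_def Upper_def pattern_order_def)
  have ub: "a \<sqsubseteq>\<^bsub>L\<^esub> P" if "a \<in> A" for a
    using lub A that by (auto simp: least_def Upper_def pattern_order_def)
  have least: "P \<sqsubseteq>\<^bsub>L\<^esub> U" if "U \<in> patterns S" "\<And>a. a \<in> A \<Longrightarrow> a \<sqsubseteq>\<^bsub>L\<^esub> U" for U
    using lub that by (auto simp: least_def Upper_def pattern_order_def)
  have "act S g P \<sqsubseteq>\<^bsub>L\<^esub> U"
    if U: "U \<in> patterns S" and b: "\<And>a. a \<in> A \<Longrightarrow> act S g a \<sqsubseteq>\<^bsub>L\<^esub> U" for U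
  proof -
    have "a \<sqsubseteq>\<^bsub>L\<^esub> act S (inv\<^bsub>G\<^esub> g) U" if "a \<in> A" for a
      using act_mono[OF _ U _ b[OF that], of "inv\<^bsub>G\<^esub> g"] act_inv_cancel(1)[OF g, of a]
        act_closed[OF g, of a] g A that by auto
    then have "P \<sqsubseteq>\<^bsub>L\<^esub> act S (inv\<^bsub>G\<^esub> g) U" using least act_closed g U by simp
    then have "act S g P \<sqsubseteq>\<^bsub>L\<^esub> act S g (act S (inv\<^bsub>G\<^esub> g) U)"
      using act_mono g P U act_closed by simp
    then show ?thesis using act_inv_cancel(2)[OF g U] by simp
  qed
  moreover have "act S g a \<sqsubseteq>\<^bsub>L\<^esub> act S g P" if "a \<in> A" for a
    using act_mono[OF g P _ ub[OF that]] A that by blast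
  ultimately show ?thesis
    using P act_closed[OF g] A
    by (auto simp: least_def Upper_def) (auto simp: pattern_order_def subset_iff)
qed

section \<open>Glueing makes a pattern a local object\<close>

text \<open>
  The empty family is locally finite and pairwise compatible, so glueing it gives a least pattern.
  That pattern is a cut of \<open>cut S P {}\<close>, and cutting \<open>cut S P {}\<close> changes nothing.
\<close>

lemma cut_empty_least:
  assumes "glueable m S" "X = mtopology_of m" "P \<in> patterns S" "Q \<in> patterns S"
  shows "cut S P {} \<sqsubseteq>\<^bsub>L\<^esub> Q"
proof -
  have "locally_finite_patterns m S {}" "pairwise_compatible (mtopology_of m) S {}"
    by (auto simp: locally_finite_patterns_def cut_family_def pairwise_compatible_def)
  then obtain z where "is_lub L z {}"
    using assms(1,2) unfolding glueable_def by blast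
  then have z: "z \<in> patterns S" and zle: "\<And>R. R \<in> patterns S \<Longrightarrow> z \<sqsubseteq>\<^bsub>L\<^esub> R"
    by (auto simp: least_def Upper_def pattern_order_def)
  have "cut S P {} = z"
  proof -
    have ce: "cut S P {} \<in> patterns S" using cut_closed assms(3) by simp
    obtain C where "closedin X C" "z = cut S (cut S P {}) C"
      using zle[OF ce] le_iff_cut[OF ce z] by blast
    then show ?thesis using cut_cut[OF assms(3), of "{}" C] by simp
  qed
  then show ?thesis using zle assms(4) by simp
qed

text \<open>
  Members that \<open>C\<close> cuts down to the least pattern put no constraint on upper bounds. Hence the two
  families, cut by \<open>C\<close>, have the same upper bounds once their other members agree, and by
  glueability their least upper bounds are \<open>cut S P C\<close> and \<open>cut S Q C\<close>.
\<close>

lemma cut_eq_of_glued_families: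
  assumes glue: "glueable m S" and X: "X = mtopology_of m"
    and A: "A \<subseteq> patterns S" "locally_finite_patterns m S A" "is_lub L P A"
    and B: "B \<subseteq> patterns S" "locally_finite_patterns m S B" "is_lub L Q B"
    and C: "closedin X C"
    and AB: "\<And>a. \<lbrakk>a \<in> A; cut S a C \<noteq> cut S a {}\<rbrakk> \<Longrightarrow> cut S a C \<in> cut_family S B C"
    and BA: "\<And>b. \<lbrakk>b \<in> B; cut S b C \<noteq> cut S b {}\<rbrakk> \<Longrightarrow> cut S b C \<in> cut_family S A C"
  shows "cut S P C = cut S Q C"
proof -
  interpret L: partial_order L by (rule partial_order_pattern_order)
  have lub_cut: "is_lub L (cut S R C) (cut_family S F C)"
    if F: "F \<subseteq> patterns S" "locally_finite_patterns m S F" "is_lub L R F" for R F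
  proof -
    have "R \<in> patterns S" "\<And>a. a \<in> F \<Longrightarrow> a \<sqsubseteq>\<^bsub>L\<^esub> R"
      using F by (auto simp: least_def Upper_def pattern_order_def)
    \<comment> \<open>The supremum is a common upper bound of any two members.\<close>
    then have "pairwise_compatible X S F" unfolding pairwise_compatible_def by blast
    \<comment> \<open>Glueability speaks of some supremum of the family; by uniqueness it is the given one.\<close>
    then obtain R' where R': "is_lub L R' F" "is_lub L (cut S R' C) (cut_family S F C)"
      using glue F C unfolding glueable_def X by blast
    then show ?thesis using L.least_unique F(3) by blast
  qed
  have sub: "Upper L (cut_family S F C) \<subseteq> Upper L (cut_family S F' C)"
    if "F' \<subseteq> patterns S"
      and "\<And>a. \<lbrakk>a \<in> F'; cut S a C \<noteq> cut S a {}\<rbrakk> \<Longrightarrow> cut S a C \<in> cut_family S F C" for F F'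
  proof
    fix U assume U: "U \<in> Upper L (cut_family S F C)"
    have UP: "U \<in> patterns S" using U by (auto simp: Upper_def pattern_order_def)
    have "cut S a C \<sqsubseteq>\<^bsub>L\<^esub> U" if "a \<in> F'" for a
    proof (cases "cut S a C = cut S a {}")
      case True
      then show ?thesis using cut_empty_least[OF glue X _ UP] that \<open>F' \<subseteq> patterns S\<close> by auto
    next
      case False
      moreover have "cut S a C \<in> patterns S" using cut_closed C that \<open>F' \<subseteq> patterns S\<close> by blast
      ultimately show ?thesis using U that(1) \<open>\<And>a. _ \<Longrightarrow> _ \<Longrightarrow> cut S a C \<in> cut_family S F C\<close>
        by (auto simp: Upper_def pattern_order_def)
    qed
    then show "U \<in> Upper L (cut_family S F' C)"
      using UP by (auto simp: Upper_def cut_family_def) (simp add: pattern_order_def)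
  qed
  have "Upper L (cut_family S A C) = Upper L (cut_family S B C)"
    using sub[OF A(1) AB] sub[OF B(1) BA] by blast
  then show ?thesis using L.least_unique lub_cut[OF A] lub_cut[OF B] by metis
qed

end

text \<open>
  Only finitely many points of \<open>D\<close> lie close enough to a given ball for their patches to reach it;
  all other patches are cut to \<open>cut S P {}\<close>.
\<close>

lemma locally_finite_ball_patches:
  fixes S :: "('g, 'a::heine_borel, 'p) pattern_structure"
  assumes aps: "abstract_pattern_space G euclidean mv S"
    and "P \<in> patterns S" and D: "uniform_discrete D"
  shows "locally_finite_patterns euclidean_metric S {cut S P (cball x R) |x. x \<in> D}"
  unfolding locally_finite_patterns_def
proof (intro ballI allI impI)
  fix z :: 'a and r :: real assume "r > 0"
  interpret abstract_pattern_space G euclidean mv S by (rule aps)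
  have mb: "mcball_of euclidean_metric z r = cball z r" by auto
  let ?E = "D \<inter> cball z (r + R)"
  have "finite ?E"
    using uniform_discrete_finite_iff[of ?E] uniform_discrete_subset[OF D, of ?E]
      bounded_subset[OF bounded_cball] by blast
  moreover have "cut_family S {cut S P (cball x R) |x. x \<in> D} (cball z r)
    \<subseteq> insert (cut S P {}) ((\<lambda>x. cut S P (cball x R \<inter> cball z r)) ` ?E)"
  proof
    fix Q assume "Q \<in> cut_family S {cut S P (cball x R) |x. x \<in> D} (cball z r)"
    then obtain x where x: "x \<in> D" "Q = cut S P (cball x R \<inter> cball z r)"
      using cut_cut[OF assms(2)] by (auto simp: cut_family_def)
    show "Q \<in> insert (cut S P {}) ((\<lambda>x. cut S P (cball x R \<inter> cball z r)) ` ?E)"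
    proof (cases "cball x R \<inter> cball z r = {}")
      case False
      then obtain y where "dist x y \<le> R" "dist z y \<le> r" by auto
      then have "dist z x \<le> r + R" using dist_triangle2[of z x y] by linarith
      then show ?thesis using x by auto
    qed (use x in auto)
  qed
  ultimately show "finite (cut_family S {cut S P (cball x R) |x. x \<in> D} (mcball_of euclidean_metric z r))"
    unfolding mb by (meson finite.insertI finite_imageI finite_subset)
qed

text \<open>
  A patch whose ball misses \<open>C\<close> is cut by \<open>C\<close> to the least pattern, so the patches near \<open>C\<close>
  are all that the supremum sees there.
\<close>

lemma cut_eq_of_ball_patches:
  fixes S :: "('g, 'a::heine_borel, 'p) pattern_structure"
  assumes aps: "abstract_pattern_space G euclidean mv S"
    and glue: "glueable euclidean_metric S"
    and P: "P \<in> patterns S" "uniform_discrete D"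
      "is_lub (pattern_order euclidean S) P {cut S P (cball x R) |x. x \<in> D}"
    and Q: "Q \<in> patterns S" "uniform_discrete E"
      "is_lub (pattern_order euclidean S) Q {cut S Q (cball x R) |x. x \<in> E}"
    and C: "closed C"
    and DE: "\<And>x. \<lbrakk>x \<in> D; cball x R \<inter> C \<noteq> {}\<rbrakk> \<Longrightarrow> x \<in> E \<and> cut S Q (cball x R) = cut S P (cball x R)"
    and ED: "\<And>x. \<lbrakk>x \<in> E; cball x R \<inter> C \<noteq> {}\<rbrakk> \<Longrightarrow> x \<in> D \<and> cut S P (cball x R) = cut S Q (cball x R)"
  shows "cut S P C = cut S Q C"
proof -
  interpret abstract_pattern_space G euclidean mv S by (rule aps)
  have patch: "cut S a C \<in> cut_family S {cut S P2 (cball x R) |x. x \<in> D2} C"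
    if P1: "P1 \<in> patterns S" and agree: "\<And>x. \<lbrakk>x \<in> D1; cball x R \<inter> C \<noteq> {}\<rbrakk>
        \<Longrightarrow> x \<in> D2 \<and> cut S P2 (cball x R) = cut S P1 (cball x R)"
      and a: "a \<in> {cut S P1 (cball x R) |x. x \<in> D1}" and ne: "cut S a C \<noteq> cut S a {}"
    for P1 P2 D1 D2 a
  proof -
    obtain x where x: "x \<in> D1" "a = cut S P1 (cball x R)" using a by blast
    have "cball x R \<inter> C \<noteq> {}"
      using ne x cut_cut[OF P1, of "cball x R" C] cut_cut[OF P1, of "cball x R" "{}"] C by auto
    then show ?thesis using agree[OF x(1)] x(2) by (auto simp: cut_family_def intro!: imageI)
  qed
  show ?thesis
    by (rule cut_eq_of_glued_families[OF glue mtopology_of_euclidean[symmetric]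
          _ locally_finite_ball_patches[OF aps P(1,2)] P(3)
          _ locally_finite_ball_patches[OF aps Q(1,2)] Q(3)])
      (use P(1) Q(1) C cut_closed patch[OF P(1) DE] patch[OF Q(1) ED] in auto)
qed

section \<open>Plans are equivariant\<close>

lemma isom_image_cball:
  assumes "subgroup \<Gamma> euclidean_group" "g \<in> \<Gamma>"
  shows "isom_apply g ` cball x r = cball (isom_apply g x) r"
proof (intro equalityI subsetI)
  fix y assume y: "y \<in> cball (isom_apply g x) r"
  obtain w where w: "y = isom_apply g w"
    using group_action.surj_prop[OF group_action_isom_apply[OF assms(1)], of g] assms(2)
    by (auto simp: subgroup_monoid_def)
  then show "y \<in> isom_apply g ` cball x r"
    using y dist_isom_apply[OF subgroup_carrier[OF assms]] by auto
qed (auto simp: dist_isom_apply[OF subgroup_carrier[OF assms]])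

text \<open>
  If \<open>k\<close> carries a component onto the patch of \<open>P\<close> at \<open>k0\<close>, then by equivariance of cutting \<open>gk\<close>
  carries it onto the patch of \<open>gP\<close> at \<open>gk0\<close>.
\<close>

lemma plan_equivariant:
  assumes sg: "subgroup \<Gamma> euclidean_group"
    and aps: "abstract_pattern_space (subgroup_monoid \<Gamma>) euclidean isom_apply S"
    and P: "P \<in> patterns S" and comps: "\<And>l. l \<in> \<Lambda> \<Longrightarrow> comps l \<in> patterns S"
    and g: "g \<in> \<Gamma>"
  shows "act (plan_structure \<Gamma> \<Lambda>) g (plan \<Gamma> S D R P \<Lambda> comps)
    = plan \<Gamma> S (isom_apply g ` D) R (act S g P) \<Lambda> comps"
proof -
  interpret abstract_pattern_space "subgroup_monoid \<Gamma>" euclidean isom_apply S by (rule aps)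
  interpret G: group "subgroup_monoid \<Gamma>" by (rule group_subgroup_monoid[OF sg])
  have carrier [simp]: "carrier (subgroup_monoid \<Gamma>) = \<Gamma>" by (simp add: subgroup_monoid_def)
  have apply_mult: "isom_apply (h \<otimes>\<^bsub>subgroup_monoid \<Gamma>\<^esub> k) x = isom_apply h (isom_apply k x)" for h k x
    by (simp add: subgroup_monoid_simps[OF sg] isom_apply_mult)
  have move: "h \<otimes>\<^bsub>subgroup_monoid \<Gamma>\<^esub> k \<in> plan \<Gamma> S (isom_apply h ` D') R (act S h P') \<Lambda> comps l"
    if h: "h \<in> \<Gamma>" and l: "l \<in> \<Lambda>" and P': "P' \<in> patterns S"
      and k: "k \<in> plan \<Gamma> S D' R P' \<Lambda> comps l" for h k l P' D'
  proof -
    have k': "k \<in> \<Gamma>" "isom_apply k 0 \<in> D'" "cut S P' (cball (isom_apply k 0) R) = act S k (comps l)"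
      using k l by (auto simp: plan_def)
    have "cut S (act S h P') (cball (isom_apply h (isom_apply k 0)) R)
      = act S h (cut S P' (cball (isom_apply k 0) R))"
      using cut_equivariant[of h P' "cball (isom_apply k 0) R"] h P'
      by (simp add: isom_image_cball[OF sg])
    also have "\<dots> = act S (h \<otimes>\<^bsub>subgroup_monoid \<Gamma>\<^esub> k) (comps l)"
      using pattern.composition_rule[OF comps[OF l]] h k' by simp
    finally show ?thesis using h k' l G.m_closed[of h k] by (auto simp: plan_def apply_mult)
  qed
  \<comment> \<open>The claim \<open>move\<close> is one inclusion; applied to the inverse of \<open>g\<close> it yields the other.\<close>
  let ?g' = "inv\<^bsub>subgroup_monoid \<Gamma>\<^esub> g"
  have "g <#\<^bsub>subgroup_monoid \<Gamma>\<^esub> plan \<Gamma> S D R P \<Lambda> comps l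
    = plan \<Gamma> S (isom_apply g ` D) R (act S g P) \<Lambda> comps l" if l: "l \<in> \<Lambda>" for l
  proof (intro equalityI subsetI)
    fix h assume "h \<in> g <#\<^bsub>subgroup_monoid \<Gamma>\<^esub> plan \<Gamma> S D R P \<Lambda> comps l"
    then show "h \<in> plan \<Gamma> S (isom_apply g ` D) R (act S g P) \<Lambda> comps l"
      using move[OF g l P] by (auto simp: l_coset_def)
  next
    fix h assume h: "h \<in> plan \<Gamma> S (isom_apply g ` D) R (act S g P) \<Lambda> comps l"
    then have h\<Gamma>: "h \<in> \<Gamma>" using l by (simp add: plan_def)
    have "isom_apply ?g' (isom_apply g x) = x" for x
      using G.l_inv[of g] g apply_mult[of ?g' g x] isom_apply_one[of x]
      by (simp add: subgroup_monoid_simps(3)[OF sg])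
    then have "isom_apply ?g' ` isom_apply g ` D = D" by (simp add: image_image)
    then have "?g' \<otimes>\<^bsub>subgroup_monoid \<Gamma>\<^esub> h \<in> plan \<Gamma> S D R P \<Lambda> comps l"
      using move[OF _ l act_closed h, of ?g'] act_inv_cancel(1)[of g P] g P G.inv_closed[of g] by simp
    moreover have "h = g \<otimes>\<^bsub>subgroup_monoid \<Gamma>\<^esub> (?g' \<otimes>\<^bsub>subgroup_monoid \<Gamma>\<^esub> h)"
      using G.m_assoc[of g ?g' h] G.r_inv[of g] g h\<Gamma> G.inv_closed[of g] G.l_one[of h] by simp
    ultimately show "h \<in> g <#\<^bsub>subgroup_monoid \<Gamma>\<^esub> plan \<Gamma> S D R P \<Lambda> comps l"
      unfolding l_coset_def by blast
  qed
  moreover have "plan \<Gamma> S D R P \<Lambda> comps \<in> (\<Pi>\<^sub>E l\<in>\<Lambda>. Pow \<Gamma>)"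
    by (auto simp: plan_def)
  moreover have "restrict (plan \<Gamma> S D' R P' \<Lambda> comps) \<Lambda> = plan \<Gamma> S D' R P' \<Lambda> comps" for D' P'
    by (auto simp: plan_def)
  ultimately show ?thesis
    by (auto simp: product_structure_def power_structure_def PiE_iff
      intro!: extensionalityI[where A = \<Lambda>]) (auto simp: plan_def)
qed

section \<open>Local derivability in both directions\<close>

text \<open>
  The distance of \<open>h\<close> from \<open>\<one>\<close> is the norm of its translation part \<open>h0\<close> plus the operator norm of
  \<open>mat 1 - snd h\<close>, a difference of two linear isometries.
\<close>

lemma rho_E_one_bounds:
  fixes h :: "('n::finite) isom"
  assumes "h \<in> carrier euclidean_group"
  shows "norm (isom_apply h 0) \<le> rho_E \<one>\<^bsub>euclidean_group\<^esub> h"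
    and "rho_E \<one>\<^bsub>euclidean_group\<^esub> h \<le> norm (isom_apply h 0) + 2"
proof -
  have e: "rho_E \<one>\<^bsub>euclidean_group\<^esub> h
    = norm (isom_apply h 0) + onorm (\<lambda>x. (mat 1 - snd h) *v x)"
    by (simp add: rho_E_def euclidean_group_def isom_apply_def dist_norm)
  have "norm ((mat 1 - snd h) *v v) \<le> 2 * norm v" for v
    using norm_triangle_ineq4[of v "snd h *v v"] norm_snd_isom[OF assms, of v]
    by (simp add: matrix_vector_mult_diff_rdistrib)
  then have "onorm (\<lambda>x. (mat 1 - snd h) *v x) \<le> 2" by (intro onorm_le)
  then show "rho_E \<one>\<^bsub>euclidean_group\<^esub> h \<le> norm (isom_apply h 0) + 2" using e by simp
  have "onorm (\<lambda>x. (mat 1 - snd h) *v x) \<ge> 0"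
    by (intro onorm_pos_le matrix_vector_mul_bounded_linear)
  then show "norm (isom_apply h 0) \<le> rho_E \<one>\<^bsub>euclidean_group\<^esub> h" using e by simp
qed

theorem proposition4p9:
  fixes \<Gamma> :: "('n::finite) isom set"
    and S :: "('n isom, real^'n, 'p) pattern_structure"
    and P :: 'p and D :: "(real^'n) set" and R0 :: real
    and \<Lambda> :: "'l set" and comps :: "'l \<Rightarrow> 'p"
  assumes "subgroup \<Gamma> euclidean_group"
    and "closedin (mtopology_of isom_metric) \<Gamma>"
    and "\<And>a. (a, mat 1) \<in> \<Gamma>"
    and "abstract_pattern_space (subgroup_monoid \<Gamma>) euclidean isom_apply S"
    and "glueable euclidean_metric S"
    and "P \<in> patterns S"
    and "delone_set D"
    and "R0 > 0"
    and "decomposes \<Gamma> S D R0 P"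
    and "tuple_of_components \<Gamma> S D R0 P \<Lambda> comps"
  shows "mutually_locally_derivable (subgroup_monoid \<Gamma>)
    euclidean_metric S P
    (subgroup_metric \<Gamma>) (plan_structure \<Gamma> \<Lambda>) (plan \<Gamma> S D R0 P \<Lambda> comps)"
proof -
  note sg = assms(1) and aps = assms(4) and glue = assms(5) and P = assms(6)
  interpret abstract_pattern_space "subgroup_monoid \<Gamma>" euclidean isom_apply S by (rule aps)
  interpret G: group "subgroup_monoid \<Gamma>" by (rule group_subgroup_monoid[OF sg])
  let ?e = "\<one>\<^bsub>euclidean_group\<^esub> :: 'n isom"
  let ?T = "plan_structure \<Gamma> \<Lambda>" and ?pl = "plan \<Gamma> S D R0 P \<Lambda> comps"
  have carrier [simp]: "carrier (subgroup_monoid \<Gamma>) = \<Gamma>" by (simp add: subgroup_monoid_def)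
  have e\<Gamma>: "?e \<in> \<Gamma>" using subgroup.one_closed[OF sg] .
  have ud: "uniform_discrete D" using assms(7) by (simp add: delone_set_def)
  have comps: "comps l \<in> patterns S" if "l \<in> \<Lambda>" for l
    using assms(10) that by (simp add: tuple_of_components_def)
  have plan_act: "act ?T g ?pl = plan \<Gamma> S (isom_apply g ` D) R0 (act S g P) \<Lambda> comps"
    if "g \<in> \<Gamma>" for g
    using plan_equivariant[OF sg aps P comps that] .
  have cut_plan: "cut ?T (act ?T g ?pl) (mcball_of (subgroup_metric \<Gamma>) ?e r)
    = (\<lambda>l\<in>\<Lambda>. {h \<in> plan \<Gamma> S (isom_apply g ` D) R0 (act S g P) \<Lambda> comps l. rho_E ?e h \<le> r})"
    if "g \<in> \<Gamma>" for g r
  proof -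
    have "mcball_of (subgroup_metric \<Gamma>) ?e r = {h \<in> \<Gamma>. rho_E ?e h \<le> r}"
      using e\<Gamma> by (auto simp: mspace_subgroup_metric[OF sg] mdist_subgroup_metric[OF sg])
    then show ?thesis unfolding plan_act[OF that]
      by (intro ext) (auto simp: product_structure_def power_structure_def plan_def)
  qed
  have ball: "mcball_of euclidean_metric x r = cball x r" for x :: "real^'n" and r by auto
  have plan_from_P: "locally_derivable (subgroup_monoid \<Gamma>) (subgroup_metric \<Gamma>) ?T ?pl euclidean_metric S P"
  proof -
    have "locally_derivable (subgroup_monoid \<Gamma>) euclidean_metric ud_structure D euclidean_metric S P"
      using assms(9) by (simp add: decomposes_def)
    then have "\<exists>x0 y0. \<exists>R1\<ge>0. \<forall>g\<in>\<Gamma>. \<forall>h\<in>\<Gamma>. \<forall>R\<ge>0.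
      cut S (act S g P) (cball x0 (R + R1)) = cut S (act S h P) (cball x0 (R + R1))
      \<longrightarrow> isom_apply g ` D \<inter> cball y0 R = isom_apply h ` D \<inter> cball y0 R"
      using ud unfolding locally_derivable_def ball by (simp add: ud_structure_def)
    then obtain x0 y0 R1 where R1: "R1 \<ge> 0" and D_from_P: "\<And>g h R. \<lbrakk>g \<in> \<Gamma>; h \<in> \<Gamma>; R \<ge> 0;
      cut S (act S g P) (cball x0 (R + R1)) = cut S (act S h P) (cball x0 (R + R1))\<rbrakk>
      \<Longrightarrow> isom_apply g ` D \<inter> cball y0 R = isom_apply h ` D \<inter> cball y0 R"
      by metis
    \<comment> \<open>Large enough that the ball of radius \<open>R + R2\<close> about \<open>0\<close> covers both the ball about \<open>x0\<close>
      that determines the translates of \<open>D\<close> throughout \<open>cball 0 R\<close> and every patch centred in \<open>cball 0 R\<close>.\<close>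
    define R2 where "R2 = norm x0 + norm y0 + R1 + R0"
    have incl: "plan \<Gamma> S (isom_apply g ` D) R0 (act S g P) \<Lambda> comps l \<inter> {k. rho_E ?e k \<le> R}
      \<subseteq> plan \<Gamma> S (isom_apply h ` D) R0 (act S h P) \<Lambda> comps l"
      if gh: "g \<in> \<Gamma>" "h \<in> \<Gamma>" and R: "R \<ge> 0" and l: "l \<in> \<Lambda>"
        and eq: "cut S (act S g P) (cball 0 (R + R2)) = cut S (act S h P) (cball 0 (R + R2))" for g h R l
    proof
      have local: "cut S (act S g P) B = cut S (act S h P) B" if "closed B" "B \<subseteq> cball 0 (R + R2)" for B
        using cut_cut[of _ "cball 0 (R + R2)" B] eq act_closed[OF _ P] gh that
        by (metis Int_absorb1 carrier closed_cball closed_closedin)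
      have "cball x0 (R + norm y0 + R1) \<subseteq> cball 0 (R + R2)"
        using assms(8) by (simp add: cball_subset_cball_iff R2_def)
      then have D_eq: "isom_apply g ` D \<inter> cball y0 (R + norm y0) = isom_apply h ` D \<inter> cball y0 (R + norm y0)"
        using R by (intro D_from_P[OF gh] local closed_cball) auto
      fix k assume k: "k \<in> plan \<Gamma> S (isom_apply g ` D) R0 (act S g P) \<Lambda> comps l \<inter> {k. rho_E ?e k \<le> R}"
      then have k\<Gamma>: "k \<in> \<Gamma>" using l by (simp add: plan_def)
      have nk: "norm (isom_apply k 0) \<le> R"
        using rho_E_one_bounds(1)[OF subgroup_carrier[OF sg k\<Gamma>]] k by simp
      then have "isom_apply k 0 \<in> cball y0 (R + norm y0)"
        using norm_triangle_ineq4[of y0 "isom_apply k 0"] by (simp add: dist_norm)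
      then have "isom_apply k 0 \<in> isom_apply h ` D" using k l D_eq by (auto simp: plan_def)
      moreover have "norm (isom_apply k 0) + R0 \<le> R + R2"
        using nk R1 norm_ge_zero[of x0] norm_ge_zero[of y0] unfolding R2_def by linarith
      then have "cball (isom_apply k 0) R0 \<subseteq> cball 0 (R + R2)"
        by (simp add: cball_subset_cball_iff)
      then have "cut S (act S h P) (cball (isom_apply k 0) R0) = act S k (comps l)"
        using local[of "cball (isom_apply k 0) R0"] k l by (simp add: plan_def)
      ultimately show "k \<in> plan \<Gamma> S (isom_apply h ` D) R0 (act S h P) \<Lambda> comps l"
        using k\<Gamma> l by (simp add: plan_def)
    qed
    have "cut ?T (act ?T g ?pl) (mcball_of (subgroup_metric \<Gamma>) ?e R)
        = cut ?T (act ?T h ?pl) (mcball_of (subgroup_metric \<Gamma>) ?e R)"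
      if "g \<in> \<Gamma>" "h \<in> \<Gamma>" "R \<ge> 0"
        "cut S (act S g P) (cball 0 (R + R2)) = cut S (act S h P) (cball 0 (R + R2))" for g h R
      unfolding cut_plan[OF that(1)] cut_plan[OF that(2)]
      using incl[OF that(1-3) _ that(4)] incl[OF that(2,1,3) _ that(4)[symmetric]]
      by (intro restrict_ext) blast
    moreover have "R2 \<ge> 0" using R1 assms(8) by (simp add: R2_def)
    ultimately show ?thesis
      unfolding locally_derivable_def ball carrier mspace_subgroup_metric[OF sg]
      using e\<Gamma> by (metis UNIV_I mspace_euclidean_metric)
  qed
  have P_from_plan: "locally_derivable (subgroup_monoid \<Gamma>) euclidean_metric S P (subgroup_metric \<Gamma>) ?T ?pl"
  proof -
    have lub: "is_lub L (act S g P) {cut S (act S g P) (cball x R0) |x. x \<in> isom_apply g ` D}"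
      if g: "g \<in> \<Gamma>" for g
    proof -
      have "act S g ` {cut S P (cball x R0) |x. x \<in> D}
        = (\<lambda>x. cut S (act S g P) (cball (isom_apply g x) R0)) ` D"
        using cut_equivariant[of g P "cball _ R0"] g P isom_image_cball[OF sg g]
        by (auto simp: image_iff)
      also have "\<dots> = {cut S (act S g P) (cball x R0) |x. x \<in> isom_apply g ` D}" by blast
      finally show ?thesis
        using act_is_lub[of g "{cut S P (cball x R0) |x. x \<in> D}" P] g P cut_closed assms(9)
        by (auto simp: decomposes_def)
    qed
    have incl: "x \<in> isom_apply h ` D \<and> cut S (act S h P) (cball x R0) = cut S (act S g P) (cball x R0)"
      if g: "g \<in> \<Gamma>" and h: "h \<in> \<Gamma>"
        and eq: "cut ?T (act ?T g ?pl) (mcball_of (subgroup_metric \<Gamma>) ?e (R + (R0 + 2)))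
          = cut ?T (act ?T h ?pl) (mcball_of (subgroup_metric \<Gamma>) ?e (R + (R0 + 2)))"
        and x: "x \<in> isom_apply g ` D" "cball x R0 \<inter> cball 0 R \<noteq> {}" for g h R x
    proof -
      \<comment> \<open>An element of the translated plan that sends the origin to \<open>x\<close>: such an element records
        the patch at \<open>x\<close>.\<close>
      obtain y where y: "y \<in> D" "x = isom_apply g y" using x by blast
      obtain l k where l: "l \<in> \<Lambda>" and k: "k \<in> ?pl l" "y = isom_apply k 0"
        using assms(10) y(1) unfolding tuple_of_components_def plan_def by fastforce
      define k' where "k' = g \<otimes>\<^bsub>euclidean_group\<^esub> k"
      have x_k': "x = isom_apply k' 0" using y k by (simp add: k'_def isom_apply_mult)
      have "k' \<in> g <#\<^bsub>subgroup_monoid \<Gamma>\<^esub> ?pl l"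
        using k by (auto simp: l_coset_def k'_def subgroup_monoid_simps[OF sg])
      also have "\<dots> = act ?T g ?pl l"
        using l plan_in_patterns[of \<Gamma> S D R0 P \<Lambda> comps]
        by (auto simp: product_structure_def power_structure_def)
      finally have k'_g: "k' \<in> plan \<Gamma> S (isom_apply g ` D) R0 (act S g P) \<Lambda> comps l"
        using plan_act[OF g] by simp
      then have "k' \<in> \<Gamma>" using l by (simp add: plan_def)
      obtain z where "dist x z \<le> R0" "norm z \<le> R" using x by auto
      then have "norm x \<le> R + R0" using norm_triangle_sub[of x z] by (simp add: dist_norm)
      \<comment> \<open>The \<open>R0\<close> accounts for patches that reach \<open>cball 0 R\<close> from outside, the \<open>2\<close> for the
        orthogonal part of \<open>k'\<close>.\<close>
      then have "rho_E ?e k' \<le> R + (R0 + 2)"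
        using rho_E_one_bounds(2)[OF subgroup_carrier[OF sg \<open>k' \<in> \<Gamma>\<close>]] x_k' by simp
      then have k'_h: "k' \<in> plan \<Gamma> S (isom_apply h ` D) R0 (act S h P) \<Lambda> comps l"
        using fun_cong[OF eq[unfolded cut_plan[OF g] cut_plan[OF h]], of l] l k'_g by auto
      show ?thesis using k'_g k'_h l unfolding x_k' by (simp add: plan_def)
    qed
    have "cut S (act S g P) (cball 0 R) = cut S (act S h P) (cball 0 R)"
      if gh: "g \<in> \<Gamma>" "h \<in> \<Gamma>"
        and eq: "cut ?T (act ?T g ?pl) (mcball_of (subgroup_metric \<Gamma>) ?e (R + (R0 + 2)))
          = cut ?T (act ?T h ?pl) (mcball_of (subgroup_metric \<Gamma>) ?e (R + (R0 + 2)))" for g h R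
    proof (rule cut_eq_of_ball_patches[OF aps glue _ _ lub[OF gh(1)] _ _ lub[OF gh(2)]])
      show "act S g P \<in> patterns S" "act S h P \<in> patterns S"
        using act_closed[OF _ P] gh by simp_all
      show "uniform_discrete (isom_apply g ` D)" "uniform_discrete (isom_apply h ` D)"
        using uniform_discrete_isom_image[OF sg _ ud] gh by simp_all
    qed (use incl[OF gh eq] incl[OF gh(2,1) eq[symmetric]] in blast)+
    moreover have "R0 + 2 \<ge> 0" using assms(8) by simp
    ultimately show ?thesis
      unfolding locally_derivable_def ball carrier mspace_subgroup_metric[OF sg]
      using e\<Gamma> by (metis UNIV_I mspace_euclidean_metric)
  qed
  show ?thesis
    using plan_from_P P_from_plan by (simp add: mutually_locally_derivable_def)
qed

end
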